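(* For each $j=1,\dots,N$, define $$\beta_j=\sup_{\delta_j\in\Delta_j}\Omega_j(\delta_j)-\inf_{\delta_j\in\Delta_j}\Omega_j(\delta_j).$$ Let $\boldsymbol{\gamma}^*\in\boldsymbol{\Gamma}$ be an optimal regularized team decision rule, i.e. $J^{\mathsf{reg}}(\boldsymbol{\gamma}^* )=\sup_{\boldsymbol{\gamma}\in\boldsymbol{\Gamma}}J^{\mathsf{reg}}(\boldsymbol{\gamma})$. Then $$J^*-\sum_{j=1}^N\beta_j\le J(\boldsymbol{\gamma}^* )\le J^*.$$
   Context: Team model. There are $N$ agents. $\mathsf{X}$ is a Borel space (Borel subset of a complete separable metric space) with a Borel probability measure $\mathbb{P}$. For $i=1,\dots,N$, $\mathsf{U}_i$ and $\mathsf{Y}_i$ are nonempty finite sets (actions and observations of Agent $i$), and $W_i(\cdot\mid x,\mathbf{u}^{(1:i-1)})$ is a conditional probability (stochastic kernel) on $\mathsf{Y}_i$ given $\mathsf{X}\times\prod_{k=1}^{i-1}\mathsf{U}_k$. The reward function $p:\mathsf{X}\times\prod_i\mathsf{Y}_i\times\prod_i\mathsf{U}_i\to[0,\infty)$ is measurable. Put $\mathbf{y}=(y_1,\dots,y_N)$, $\mathbf{u}=(u_1,\dots,u_N)$. Define $$r(\mathbf{y},\mathbf{u})=\int_{\mathsf{X}}p(x,\mathbf{y},\mathbf{u})\prod_{i=1}^N|\mathsf{Y}_i|\,W_i(y_i\mid x,\mathbf{u}^{(1:i-1)})\,\mathbb{P}(dx),$$ assumed finite, and let $\pi_i$ be the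 uniform distribution on $\mathsf{Y}_i$. $\Delta_i\subset\mathbb{R}^{\mathsf{U}_i}$ is the set of probability distributions on $\mathsf{U}_i$. A policy of Agent $i$ is a function $\gamma_i:\mathsf{Y}_i\to\Delta_i$, also written $\gamma_i(u_i\mid y_i)$. $\Gamma_i$ is the set of such policies, and $\boldsymbol{\Gamma}=\prod_{i=1}^N\Gamma_i$. For $\boldsymbol{\gamma}\in\boldsymbol{\Gamma}$ let $\boldsymbol{\gamma}(\mathbf{y})=(\gamma_1(y_1),\dots,\gamma_N(y_N))$. For $\boldsymbol{\delta}=(\delta_1,\dots,\delta_N)\in\prod_i\Delta_i$ let $R(\mathbf{y},\boldsymbol{\delta})=\sum_{\mathbf{u}}r(\mathbf{y},\mathbf{u})\prod_{i=1}^N\delta_i(u_i)$. Original (unregularized) team problem. The reward of $\boldsymbol{\gamma}$ is $$J(\boldsymbol{\gamma})=\int_{\mathsf{X}}\sum_{\mathbf{y},\mathbf{u}}p(x,\mathbf{y},\mathbf{u})\Big(\prod_{i=1}^N W_i(y_i\mid x,\mathbf{u}^{(1:i-1)})\gamma_i(u_i\mid y_i)\Big)\mathbb{P}(dx)=\sum_{\mathbf{y}}R(\mathbf{y},\boldsymbol{\gamma}(\mathbf{y}))\prod_{i=1}^N\pi_i(y_i),$$ and $J^*=\sup_{\boldsymbol{\gamma}\in\boldsymbol{\Gamma}}J(\boldsymbol{\gamma})$. Regularization. For each $i$, $\rho_i>0$ and $\Omega_i:\Delta_i\to\mathbb{R}$ is convex and $\rho_i$-strongly convex with respect to the $\ell_1$-norm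 $\|\cdot\|_1$ on $\mathbb{R}^{\mathsf{U}_i}$: extending $\Omega_i$ by $+\infty$ outside $\Delta_i$, for all $\delta,\delta'\in\Delta_i$ and every subgradient $z\in\partial\Omega_i(\delta)$, $\Omega_i(\delta')\ge\Omega_i(\delta)+\langle z,\delta'-\delta\rangle+\frac{\rho_i}{2}\|\delta'-\delta\|_1^2$. Put $R^{\mathsf{reg}}(\mathbf{y},\boldsymbol{\delta})=R(\mathbf{y},\boldsymbol{\delta})-\sum_{i=1}^N\Omega_i(\delta_i)$ and $J^{\mathsf{reg}}(\boldsymbol{\gamma})=\sum_{\mathbf{y}}R^{\mathsf{reg}}(\mathbf{y},\boldsymbol{\gamma}(\mathbf{y}))\prod_{i=1}^N\pi_i(y_i)$. *)

theory Defs
  imports "HOL-Probability.Probability"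
begin

definition l1_norm :: "real ^ 'u \<Rightarrow> real" where
  "l1_norm x = (\<Sum>u\<in>UNIV. \<bar>x $ u\<bar>)"

definition extend_infinity :: "'v set \<Rightarrow> ('v \<Rightarrow> real) \<Rightarrow> 'v \<Rightarrow> ereal" where
  "extend_infinity D f v = (if v \<in> D then ereal (f v) else \<infinity>)"

definition subdifferential :: "('v::real_inner \<Rightarrow> ereal) \<Rightarrow> 'v \<Rightarrow> 'v set" where
  "subdifferential f v = {z. \<forall>w. f w \<ge> f v + ereal (z \<bullet> (w - v))}"

definition strongly_convex_l1_on :: "(real ^ 'u) set \<Rightarrow> real \<Rightarrow> (real ^ 'u \<Rightarrow> real) \<Rightarrow> bool" where
  "strongly_convex_l1_on D \<rho> f \<longleftrightarrow>
    (\<forall>\<delta>\<in>D. \<forall>\<delta>'\<in>D. \<forall>z\<in>subdifferential (extend_infinity D f) \<delta>.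
      f \<delta>' \<ge> f \<delta> + z \<bullet> (\<delta>' - \<delta>) + \<rho> / 2 * (l1_norm (\<delta>' - \<delta>))\<^sup>2)"

text \<open>The action sets are subsets of a common finite type \<open>'u\<close>, and the space of real functions on
  an action set \<open>A\<close> is the subspace of \<open>real ^ 'u\<close> of vectors vanishing outside \<open>A\<close>. A subgradient
  may have arbitrary coordinates outside \<open>A\<close>, but these do not contribute to its inner product with
  a difference of two distributions on \<open>A\<close>.\<close>

definition distributions :: "'u set \<Rightarrow> (real ^ 'u) set" where
  "distributions A =
    {\<delta>. (\<forall>u\<in>A. 0 \<le> \<delta> $ u) \<and> (\<forall>u. u \<notin> A \<longrightarrow> \<delta> $ u = 0) \<and> (\<Sum>u\<in>A. \<delta> $ u) = 1}"

text \<open>The agents are \<open>1, \<dots>, N\<close>. The kernel of Agent \<open>i\<close> takes the state and the actions of the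
  agents before \<open>i\<close>. Its values are probability measures on the observation set.\<close>

locale team = prob_space P
  for P :: "'x::polish_space measure" +
  fixes X :: "'x set"
    and N :: nat
    and U :: "nat \<Rightarrow> 'u::finite set"
    and Y :: "nat \<Rightarrow> 'y set"
    and W :: "nat \<Rightarrow> 'x \<times> (nat \<Rightarrow> 'u) \<Rightarrow> 'y measure"
    and p :: "'x \<Rightarrow> (nat \<Rightarrow> 'y) \<Rightarrow> (nat \<Rightarrow> 'u) \<Rightarrow> real"
  assumes X_borel: "X \<in> sets borel"
    and sets_P: "sets P = sets (restrict_space borel X)"
    and U_nonempty: "\<And>i. i \<in> {1..N} \<Longrightarrow> U i \<noteq> {}"
    and Y_finite: "\<And>i. i \<in> {1..N} \<Longrightarrow> finite (Y i)"
    and Y_nonempty: "\<And>i. i \<in> {1..N} \<Longrightarrow> Y i \<noteq> {}"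
    and W_kernel: "\<And>i. i \<in> {1..N} \<Longrightarrow>
      W i \<in> restrict_space borel X \<Otimes>\<^sub>M Pi\<^sub>M {1..<i} (\<lambda>k. count_space (U k))
        \<rightarrow>\<^sub>M prob_algebra (count_space (Y i))"
    and p_measurable: "(\<lambda>(x, y, u). p x y u) \<in> borel_measurable
      (restrict_space borel X \<Otimes>\<^sub>M Pi\<^sub>M {1..N} (\<lambda>i. count_space (Y i))
        \<Otimes>\<^sub>M Pi\<^sub>M {1..N} (\<lambda>i. count_space (U i)))"
    and p_nonneg: "\<And>x y u. x \<in> X \<Longrightarrow> y \<in> Pi\<^sub>E {1..N} Y \<Longrightarrow> u \<in> Pi\<^sub>E {1..N} U \<Longrightarrow> 0 \<le> p x y u"
    and r_finite: "\<And>y u. y \<in> Pi\<^sub>E {1..N} Y \<Longrightarrow> u \<in> Pi\<^sub>E {1..N} U \<Longrightarrow>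
      integrable P (\<lambda>x. p x y u *
        (\<Prod>i=1..N. real (card (Y i)) * measure (W i (x, restrict u {1..<i})) {y i}))"
begin

definition r :: "(nat \<Rightarrow> 'y) \<Rightarrow> (nat \<Rightarrow> 'u) \<Rightarrow> real" where
  "r y u = (\<integral>x. p x y u *
    (\<Prod>i=1..N. real (card (Y i)) * measure (W i (x, restrict u {1..<i})) {y i}) \<partial>P)"

definition R :: "(nat \<Rightarrow> 'y) \<Rightarrow> (nat \<Rightarrow> real ^ 'u) \<Rightarrow> real" where
  "R y \<delta> = (\<Sum>u\<in>Pi\<^sub>E {1..N} U. r y u * (\<Prod>i=1..N. \<delta> i $ u i))"

definition policies :: "(nat \<Rightarrow> 'y \<Rightarrow> real ^ 'u) set" where
  "policies = (\<Pi>\<^sub>E i\<in>{1..N}. Y i \<rightarrow>\<^sub>E distributions (U i))"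

definition J :: "(nat \<Rightarrow> 'y \<Rightarrow> real ^ 'u) \<Rightarrow> real" where
  "J \<gamma> = (\<integral>x. (\<Sum>y\<in>Pi\<^sub>E {1..N} Y. \<Sum>u\<in>Pi\<^sub>E {1..N} U. p x y u *
    (\<Prod>i=1..N. measure (W i (x, restrict u {1..<i})) {y i} * \<gamma> i (y i) $ u i)) \<partial>P)"

definition J_opt :: real where
  "J_opt = (SUP \<gamma>\<in>policies. J \<gamma>)"

end

locale regularized_team = team P X N U Y W p
  for P :: "'x::polish_space measure"
    and X :: "'x set"
    and N :: nat
    and U :: "nat \<Rightarrow> 'u::finite set"
    and Y :: "nat \<Rightarrow> 'y set"
    and W :: "nat \<Rightarrow> 'x \<times> (nat \<Rightarrow> 'u) \<Rightarrow> 'y measure"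
    and p :: "'x \<Rightarrow> (nat \<Rightarrow> 'y) \<Rightarrow> (nat \<Rightarrow> 'u) \<Rightarrow> real" +
  fixes \<rho> :: "nat \<Rightarrow> real"
    and \<Omega> :: "nat \<Rightarrow> real ^ 'u \<Rightarrow> real"
  assumes \<rho>_pos: "\<And>i. i \<in> {1..N} \<Longrightarrow> \<rho> i > 0"
    and \<Omega>_convex: "\<And>i. i \<in> {1..N} \<Longrightarrow> convex_on (distributions (U i)) (\<Omega> i)"
    and \<Omega>_strongly_convex:
      "\<And>i. i \<in> {1..N} \<Longrightarrow> strongly_convex_l1_on (distributions (U i)) (\<rho> i) (\<Omega> i)"
begin

definition R_reg :: "(nat \<Rightarrow> 'y) \<Rightarrow> (nat \<Rightarrow> real ^ 'u) \<Rightarrow> real" where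
  "R_reg y \<delta> = R y \<delta> - (\<Sum>i=1..N. \<Omega> i (\<delta> i))"

definition J_reg :: "(nat \<Rightarrow> 'y \<Rightarrow> real ^ 'u) \<Rightarrow> real" where
  "J_reg \<gamma> = (\<Sum>y\<in>Pi\<^sub>E {1..N} Y.
    R_reg y (\<lambda>i\<in>{1..N}. \<gamma> i (y i)) * (\<Prod>i=1..N. pmf (pmf_of_set (Y i)) (y i)))"

end

text \<open>A real convex function on a simplex is bounded, and the policies form a nonempty compact set.
  Hence the real suprema and infima of \<open>\<Omega> j\<close>, \<open>J\<close> and \<open>J_reg\<close> are over nonempty bounded sets
  and are the mathematical ones.\<close>

end

theory Submission
  imports Defs
begin

text \<open>Two ingredients give both bounds. First, the expected reward of a policy is an average of the
  multilinear rewards \<open>R\<close>, with each observation vector weighted by the product of the uniform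
  distributions; so the regularized reward of \<open>\<gamma>\<close> is \<open>J \<gamma>\<close> minus the average penalty
  \<open>\<Sum>i. \<Omega> i (\<gamma> i (y i))\<close> (\<open>J_reg_eq_J_minus_mean_penalty\<close>).
  If \<open>\<gamma>*\<close> maximizes the regularized reward, then for every policy \<open>\<gamma>\<close> the loss
  \<open>J \<gamma> - J \<gamma>*\<close> is at most the difference of the average penalties, and each
  summand \<open>\<Omega> i (\<gamma> i (y i)) - \<Omega> i (\<gamma>* i (y i))\<close> is at most the oscillation \<open>\<beta> i\<close>.
  The weights sum to one, so the loss is at most \<open>\<Sum>i. \<beta> i\<close>.

  Second, this argument compares values with real suprema and infima, which is meaningful only for
  bounded families. A convex function on a simplex is bounded above by its values at
  the vertices. It is bounded below because the barycentre is a convex combination of any given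
  point, with the fixed weight \<open>1 / n\<close>, and the vertices
  (\<open>convex_on_distributions_bounded\<close>). The unregularized rewards are bounded because
  the products of probabilities in \<open>R\<close> lie in the unit interval.\<close>

section \<open>Convex functions on a simplex\<close>

lemma axis_in_distributions:
  fixes A :: "'u::finite set"
  assumes "a \<in> A"
  shows "axis a 1 \<in> distributions A"
  using assms by (auto simp: distributions_def axis_def)

lemma distributions_nonneg: "\<delta> \<in> distributions A \<Longrightarrow> 0 \<le> \<delta> $ u"
  by (cases "u \<in> A") (auto simp: distributions_def)

lemma distributions_le_one:
  fixes A :: "'u::finite set"
  assumes "\<delta> \<in> distributions A"
  shows "\<delta> $ u \<le> 1"
proof (cases "u \<in> A")
  case True
  then have "\<delta> $ u \<le> (\<Sum>v\<in>A. \<delta> $ v)"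
    using assms by (intro member_le_sum) (auto simp: distributions_def)
  then show ?thesis
    using assms by (simp add: distributions_def)
qed (use assms in \<open>auto simp: distributions_def\<close>)

lemma sum_scaleR_axis_nth:
  fixes A :: "'u::finite set"
  shows "(\<Sum>a\<in>A. c a *\<^sub>R axis a (1::real)) $ u = (if u \<in> A then c u else 0)"
  by (simp add: axis_def if_distrib [of "\<lambda>x. _ * x"] sum.delta' cong: if_cong)

text \<open>The lower bound is Jensen's inequality at the barycentre \<open>c\<close> of the simplex with \<open>n\<close>
  vertices, written as \<open>c = (1/n) \<delta> + (\<Sum>a. ((1 - \<delta> a)/n) e a)\<close> with the unit vectors \<open>e a\<close>: since
  the weight \<open>1/n\<close> is the same for all \<open>\<delta>\<close>, an arbitrarily negative value of \<open>f \<delta>\<close> would force one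
  of \<open>f c\<close>.\<close>

lemma convex_on_distributions_bounded:
  fixes f :: "real ^ 'u::finite \<Rightarrow> real"
  assumes f: "convex_on (distributions A) f" and "A \<noteq> {}"
  shows "bdd_above (f ` distributions A)" and "bdd_below (f ` distributions A)"
proof -
  define M where "M = (\<Sum>a\<in>A. \<bar>f (axis a 1)\<bar>)"
  define n where "n = real (card A)"
  define c :: "real ^ 'u" where "c = (\<Sum>a\<in>A. (1 / n) *\<^sub>R axis a 1)"
  have n: "n > 0"
    using assms by (simp add: n_def card_gt_0_iff)
  have weighted: "(\<Sum>a\<in>A. w a * f (axis a 1)) \<le> M"
    if "\<And>a. a \<in> A \<Longrightarrow> 0 \<le> w a" "\<And>a. a \<in> A \<Longrightarrow> w a \<le> 1" for w
    unfolding M_def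
  proof (rule sum_mono)
    fix a assume a: "a \<in> A"
    have "w a * f (axis a 1) \<le> w a * \<bar>f (axis a 1)\<bar>"
      using that a by (intro mult_left_mono) auto
    also have "\<dots> \<le> \<bar>f (axis a 1)\<bar>"
      using that a by (intro mult_left_le_one_le) auto
    finally show "w a * f (axis a 1) \<le> \<bar>f (axis a 1)\<bar>" .
  qed
  have upper: "f \<delta> \<le> M" if d: "\<delta> \<in> distributions A" for \<delta>
  proof -
    have "\<delta> = (\<Sum>a\<in>A. \<delta> $ a *\<^sub>R axis a 1)"
      using d unfolding vec_eq_iff sum_scaleR_axis_nth by (auto simp: distributions_def)
    then have "f \<delta> = f (\<Sum>a\<in>A. \<delta> $ a *\<^sub>R axis a 1)"
      by (rule arg_cong)
    also have "\<dots> \<le> (\<Sum>a\<in>A. \<delta> $ a * f (axis a 1))"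
      using d \<open>A \<noteq> {}\<close> axis_in_distributions distributions_nonneg
      by (intro convex_on_sum[OF _ _ f]) (auto simp: distributions_def)
    also have "\<dots> \<le> M"
      using d by (intro weighted distributions_nonneg distributions_le_one)
    finally show ?thesis .
  qed
  have lower: "n * f c - M \<le> f \<delta>" if d: "\<delta> \<in> distributions A" for \<delta>
  proof -
    \<comment> \<open>\<open>None\<close> indexes the point \<open>\<delta>\<close> itself, which may coincide with a vertex.\<close>
    define w where "w = case_option (1 / n) (\<lambda>a. (1 - \<delta> $ a) / n)"
    define v where "v = case_option \<delta> (\<lambda>a. axis a (1::real))"
    let ?I = "insert None (Some ` A)"
    have sum_I: "sum g ?I = g None + (\<Sum>a\<in>A. g (Some a))" for g :: "'u option \<Rightarrow> 'b::comm_monoid_add"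
      by (subst sum.insert) (auto simp: sum.reindex)
    have "(\<Sum>a\<in>A. (1 - \<delta> $ a) / n) = (n - 1) / n"
      using d by (simp add: sum_divide_distrib[symmetric] sum_subtractf distributions_def n_def)
    then have w1: "sum w ?I = 1"
      unfolding sum_I using n by (simp add: w_def field_simps)
    have c_eq: "c = (\<Sum>i\<in>?I. w i *\<^sub>R v i)"
      unfolding vec_eq_iff c_def sum_I using d n
      by (simp add: w_def v_def sum_scaleR_axis_nth distributions_def field_simps
               del: sum_component)
    have "f c \<le> (\<Sum>i\<in>?I. w i * f (v i))"
      unfolding c_eq
      using w1 n d axis_in_distributions distributions_le_one[OF d]
      by (intro convex_on_sum[OF _ _ f]) (auto simp: w_def v_def)
    also have "\<dots> = (f \<delta> + (\<Sum>a\<in>A. (1 - \<delta> $ a) * f (axis a 1))) / n"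
      unfolding sum_I by (simp add: w_def v_def add_divide_distrib sum_divide_distrib)
    also have "\<dots> \<le> (f \<delta> + M) / n"
      using n d by (intro divide_right_mono add_left_mono weighted)
        (auto simp: distributions_nonneg distributions_le_one)
    finally show ?thesis
      using n by (simp add: field_simps)
  qed
  show "bdd_above (f ` distributions A)" "bdd_below (f ` distributions A)"
    using upper lower by (auto intro!: bdd_aboveI2 bdd_belowI2)
qed

section \<open>Rewards as averages over observations\<close>

context team
begin

lemma policies_in_distributions:
  assumes "\<gamma> \<in> policies" "y \<in> Pi\<^sub>E {1..N} Y" "i \<in> {1..N}"
  shows "\<gamma> i (y i) \<in> distributions (U i)"
  using assms unfolding policies_def by (auto simp: PiE_iff)

abbreviation uniform_weight :: "(nat \<Rightarrow> 'y) \<Rightarrow> real" where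
  "uniform_weight y \<equiv> (\<Prod>i=1..N. pmf (pmf_of_set (Y i)) (y i))"

lemma uniform_weight_nonneg: "0 \<le> uniform_weight y"
  by (intro prod_nonneg) auto

lemma sum_uniform_weight: "(\<Sum>y\<in>Pi\<^sub>E {1..N} Y. uniform_weight y) = 1"
proof -
  have "(\<Sum>y\<in>Pi\<^sub>E {1..N} Y. uniform_weight y) = (\<Prod>i=1..N. \<Sum>a\<in>Y i. pmf (pmf_of_set (Y i)) a)"
    using Y_finite by (intro prod_sum_PiE[symmetric]) auto
  also have "\<dots> = 1"
    using Y_finite Y_nonempty by (intro prod.neutral ballI sum_pmf_eq_1) auto
  finally show ?thesis .
qed

lemma uniform_mean_const: "(\<Sum>y\<in>Pi\<^sub>E {1..N} Y. c * uniform_weight y) = c"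
  by (simp only: sum_distrib_left[symmetric] sum_uniform_weight mult_1_right)

text \<open>The factors \<open>card (Y i)\<close> in \<open>r\<close> cancel against the uniform probabilities.\<close>

lemma J_eq_mean_R:
  "J \<gamma> = (\<Sum>y\<in>Pi\<^sub>E {1..N} Y. R y (\<lambda>i. \<gamma> i (y i)) * uniform_weight y)"
proof -
  let ?q = "\<lambda>y u x. p x y u *
    (\<Prod>i=1..N. real (card (Y i)) * measure (W i (x, restrict u {1..<i})) {y i})"
  let ?g = "\<lambda>y u. (\<Prod>i=1..N. \<gamma> i (y i) $ u i)"
  have factor: "p x y u * (\<Prod>i=1..N. measure (W i (x, restrict u {1..<i})) {y i} * \<gamma> i (y i) $ u i)
      = ?q y u x * (?g y u * uniform_weight y)"
    if "y \<in> Pi\<^sub>E {1..N} Y" for x y u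
  proof -
    have "pmf (pmf_of_set (Y i)) (y i) * real (card (Y i)) = 1" if "i \<in> {1..N}" for i
      using that \<open>y \<in> _\<close> Y_finite Y_nonempty by (auto simp: pmf_of_set PiE_iff)
    then have "(\<Prod>i=1..N. measure (W i (x, restrict u {1..<i})) {y i} * \<gamma> i (y i) $ u i) =
      (\<Prod>i=1..N. (real (card (Y i)) * measure (W i (x, restrict u {1..<i})) {y i}) *
        (\<gamma> i (y i) $ u i * pmf (pmf_of_set (Y i)) (y i)))"
      by (intro prod.cong) (auto simp: algebra_simps)
    then show ?thesis
      by (simp add: prod.distrib)
  qed
  have "J \<gamma> = (\<integral>x. (\<Sum>y\<in>Pi\<^sub>E {1..N} Y. \<Sum>u\<in>Pi\<^sub>E {1..N} U.
      ?q y u x * (?g y u * uniform_weight y)) \<partial>P)"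
    unfolding J_def by (intro Bochner_Integration.integral_cong sum.cong factor refl)
  also have "\<dots> = (\<Sum>y\<in>Pi\<^sub>E {1..N} Y. \<Sum>u\<in>Pi\<^sub>E {1..N} U. r y u * (?g y u * uniform_weight y))"
    unfolding r_def
    by (simp add: Bochner_Integration.integral_sum Bochner_Integration.integrable_sum r_finite
        integrable_mult_left del: One_nat_def cong: sum.cong)
  also have "\<dots> = (\<Sum>y\<in>Pi\<^sub>E {1..N} Y. R y (\<lambda>i. \<gamma> i (y i)) * uniform_weight y)"
    by (simp add: R_def sum_distrib_right mult.assoc)
  finally show ?thesis .
qed

lemma bdd_above_J: "bdd_above (J ` policies)"
proof (rule bdd_aboveI2)
  fix \<gamma> assume g: "\<gamma> \<in> policies"
  have "R y (\<lambda>i. \<gamma> i (y i)) \<le> (\<Sum>u\<in>Pi\<^sub>E {1..N} U. \<bar>r y u\<bar>)" if y: "y \<in> Pi\<^sub>E {1..N} Y" for y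
    unfolding R_def
  proof (rule sum_mono)
    fix u
    let ?c = "\<Prod>i=1..N. \<gamma> i (y i) $ u i"
    have d: "\<gamma> i (y i) \<in> distributions (U i)" if "i \<in> {1..N}" for i
      using policies_in_distributions[OF g y that] .
    have "0 \<le> ?c" "?c \<le> 1"
      by (intro prod_nonneg prod_le_1 ballI conjI distributions_nonneg[OF d]
          distributions_le_one[OF d]; assumption)+
    then have "\<bar>r y u\<bar> * ?c \<le> \<bar>r y u\<bar>"
      by (intro mult_right_le_one_le) auto
    moreover have "r y u * ?c \<le> \<bar>r y u\<bar> * ?c"
      using \<open>0 \<le> ?c\<close> by (intro mult_right_mono) auto
    ultimately show "r y u * ?c \<le> \<bar>r y u\<bar>"
      by linarith
  qed
  then show "J \<gamma> \<le> (\<Sum>y\<in>Pi\<^sub>E {1..N} Y. (\<Sum>u\<in>Pi\<^sub>E {1..N} U. \<bar>r y u\<bar>) * uniform_weight y)"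
    unfolding J_eq_mean_R by (intro sum_mono mult_right_mono uniform_weight_nonneg)
qed

end

context regularized_team
begin

lemma J_reg_eq_J_minus_mean_penalty:
  "J_reg \<gamma> = J \<gamma> - (\<Sum>y\<in>Pi\<^sub>E {1..N} Y. (\<Sum>i=1..N. \<Omega> i (\<gamma> i (y i))) * uniform_weight y)"
  by (simp add: J_reg_def R_reg_def R_def J_eq_mean_R left_diff_distrib sum_subtractf)

lemma \<Omega>_bounded:
  assumes "i \<in> {1..N}"
  shows "bdd_above (\<Omega> i ` distributions (U i))" and "bdd_below (\<Omega> i ` distributions (U i))"
  using convex_on_distributions_bounded[OF \<Omega>_convex U_nonempty] assms by auto

lemma mean_penalty_bounds:
  fixes \<gamma> :: "nat \<Rightarrow> 'y \<Rightarrow> real ^ 'u"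
  assumes g: "\<gamma> \<in> policies"
  defines "K \<equiv> \<Sum>y\<in>Pi\<^sub>E {1..N} Y. (\<Sum>i=1..N. \<Omega> i (\<gamma> i (y i))) * uniform_weight y"
  shows "K \<le> (\<Sum>i=1..N. SUP \<delta>\<in>distributions (U i). \<Omega> i \<delta>)"
    and "(\<Sum>i=1..N. INF \<delta>\<in>distributions (U i). \<Omega> i \<delta>) \<le> K"
proof -
  have d: "\<gamma> i (y i) \<in> distributions (U i)" if "y \<in> Pi\<^sub>E {1..N} Y" "i \<in> {1..N}" for y i
    using policies_in_distributions[OF g that] .
  have "K \<le> (\<Sum>y\<in>Pi\<^sub>E {1..N} Y.
      (\<Sum>i=1..N. SUP \<delta>\<in>distributions (U i). \<Omega> i \<delta>) * uniform_weight y)"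
    unfolding K_def
    by (intro sum_mono mult_right_mono uniform_weight_nonneg cSUP_upper d \<Omega>_bounded)
  then show "K \<le> (\<Sum>i=1..N. SUP \<delta>\<in>distributions (U i). \<Omega> i \<delta>)"
    by (simp only: uniform_mean_const)
  have "(\<Sum>y\<in>Pi\<^sub>E {1..N} Y.
      (\<Sum>i=1..N. INF \<delta>\<in>distributions (U i). \<Omega> i \<delta>) * uniform_weight y) \<le> K"
    unfolding K_def
    by (intro sum_mono mult_right_mono uniform_weight_nonneg cINF_lower d \<Omega>_bounded)
  then show "(\<Sum>i=1..N. INF \<delta>\<in>distributions (U i). \<Omega> i \<delta>) \<le> K"
    by (simp only: uniform_mean_const)
qed

text \<open>Without this bound, attaining the real supremum of \<open>J_reg\<close> would not mean being a maximizer.\<close>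

lemma bdd_above_J_reg: "bdd_above (J_reg ` policies)"
proof -
  obtain B where B: "\<And>\<gamma>. \<gamma> \<in> policies \<Longrightarrow> J \<gamma> \<le> B"
    using bdd_above_J by (auto simp: bdd_above_def)
  have "J_reg \<gamma> \<le> B - (\<Sum>i=1..N. INF \<delta>\<in>distributions (U i). \<Omega> i \<delta>)" if "\<gamma> \<in> policies" for \<gamma>
    unfolding J_reg_eq_J_minus_mean_penalty
    by (intro diff_mono B mean_penalty_bounds that)
  then show ?thesis
    by (intro bdd_aboveI2)
qed

end

section \<open>The loss of a regularized optimum\<close>

theorem corollary1:
  fixes P :: "'x::polish_space measure"
    and X :: "'x set"
    and N :: nat
    and U :: "nat \<Rightarrow> 'u::finite set"
    and Y :: "nat \<Rightarrow> 'y set"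
    and W :: "nat \<Rightarrow> 'x \<times> (nat \<Rightarrow> 'u) \<Rightarrow> 'y measure"
    and p :: "'x \<Rightarrow> (nat \<Rightarrow> 'y) \<Rightarrow> (nat \<Rightarrow> 'u) \<Rightarrow> real"
    and \<rho> :: "nat \<Rightarrow> real"
    and \<Omega> :: "nat \<Rightarrow> real ^ 'u \<Rightarrow> real"
    and \<beta> :: "nat \<Rightarrow> real"
    and \<gamma>_opt :: "nat \<Rightarrow> 'y \<Rightarrow> real ^ 'u"
  assumes "regularized_team P X N U Y W p \<rho> \<Omega>"
    and "\<And>j. j \<in> {1..N} \<Longrightarrow>
      \<beta> j = (SUP \<delta>\<in>distributions (U j). \<Omega> j \<delta>) - (INF \<delta>\<in>distributions (U j). \<Omega> j \<delta>)"
    and "\<gamma>_opt \<in> team.policies N U Y"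
    and "regularized_team.J_reg P N U Y W p \<Omega> \<gamma>_opt =
      (SUP \<gamma>\<in>team.policies N U Y. regularized_team.J_reg P N U Y W p \<Omega> \<gamma>)"
  shows "team.J_opt P N U Y W p - (\<Sum>j=1..N. \<beta> j) \<le> team.J P N U Y W p \<gamma>_opt
    \<and> team.J P N U Y W p \<gamma>_opt \<le> team.J_opt P N U Y W p"
proof -
  interpret regularized_team P X N U Y W p \<rho> \<Omega> by (rule assms(1))
  have \<beta>_sum: "(\<Sum>j=1..N. \<beta> j) = (\<Sum>j=1..N. SUP \<delta>\<in>distributions (U j). \<Omega> j \<delta>)
      - (\<Sum>j=1..N. INF \<delta>\<in>distributions (U j). \<Omega> j \<delta>)"
    using assms(2) by (simp add: sum_subtractf)
  have loss: "J \<gamma> \<le> J \<gamma>_opt + (\<Sum>j=1..N. \<beta> j)" if "\<gamma> \<in> policies" for \<gamma>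
  proof -
    have "J_reg \<gamma> \<le> J_reg \<gamma>_opt"
      unfolding assms(4) using that bdd_above_J_reg by (rule cSUP_upper)
    then show ?thesis
      using mean_penalty_bounds(1)[OF that] mean_penalty_bounds(2)[OF assms(3)]
      unfolding J_reg_eq_J_minus_mean_penalty \<beta>_sum by linarith
  qed
  have "J_opt \<le> J \<gamma>_opt + (\<Sum>j=1..N. \<beta> j)"
    unfolding J_opt_def using assms(3) loss by (intro cSUP_least) auto
  moreover have "J \<gamma>_opt \<le> J_opt"
    unfolding J_opt_def using assms(3) bdd_above_J by (rule cSUP_upper)
  ultimately show ?thesis
    by simp
qed

end
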